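(* Let $G$ be a path of length $L>0$, regarded as a metric graph, and let $w\ge 0$ be an integer. For every graph $G_w$ obtained from $G$ by adding $w$ wormholes, $\mathrm{diam}(G_w)\ge L/(w+1)$, and there is a choice of $w$ wormholes for which $\mathrm{diam}(G_w)=L/(w+1)$.
   Context: A metric graph is a finite edge-weighted graph regarded as a metric space in which all points in the interior of each edge are included and each edge is locally isometric to an interval whose length is the edge weight; $\mathrm{diam}(G)=\max_{x,y\in G} d_G(x,y)$ over all points of $G$, where $d_G(x,y)$ is the minimum length of a path from $x$ to $y$. A path of length $L$ is an interval of length $L$. A wormhole is a pair of points of $G$ (arbitrary points, not necessarily vertices); adding a wormhole means identifying its two points, equivalently adding an edge of length zero between them. $G_w$ is the metric graph obtained after all the identifications. Different wormholes may share points. *)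

theory Defs
  imports "HOL-Analysis.Analysis" "Graph_Theory.Digraph"
begin

text \<open>
  A finite edge-weighted graph. Loops and parallel edges are allowed. The orientation of the
  arcs only serves to fix a parametrisation of each edge.
\<close>

locale weighted_graph = fin_digraph G for G :: "('v, 'e) pre_digraph" +
  fixes weight :: "'e \<Rightarrow> real"
  assumes weight_pos: "e \<in> arcs G \<Longrightarrow> weight e > 0"

text \<open>
  A weighted graph regarded as a space, or such a space after identifying points: each edge \<open>e\<close> is
  parametrised by arc length through \<open>curve e\<close>, of which only the values on
  \<open>{0..len e}\<close> matter.
\<close>

record ('p, 'e) metric_graph =
  points :: "'p set"
  edges :: "'e set"
  len :: "'e \<Rightarrow> real"
  curve :: "'e \<Rightarrow> real \<Rightarrow> 'p"

datatype ('v, 'e) point = Vertex 'v | Inner 'e real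

definition metric_graph_of ::
    "('v, 'e) pre_digraph \<Rightarrow> ('e \<Rightarrow> real) \<Rightarrow> (('v, 'e) point, 'e) metric_graph" where
  "metric_graph_of G weight =
     \<lparr>points = Vertex ` verts G \<union> {Inner e t | e t. e \<in> arcs G \<and> 0 < t \<and> t < weight e},
      edges = arcs G,
      len = weight,
      curve = (\<lambda>e t. if t = 0 then Vertex (tail G e)
                    else if t = weight e then Vertex (head G e)
                    else Inner e t)\<rparr>"

text \<open>
  \<open>path_length M p l q\<close>: there is a path of length \<open>l\<close> from \<open>p\<close> to \<open>q\<close>. A path is a finite
  concatenation of segments, each running monotonically along one edge.
\<close>

inductive path_length :: "('p, 'e) metric_graph \<Rightarrow> 'p \<Rightarrow> real \<Rightarrow> 'p \<Rightarrow> bool"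
  for M :: "('p, 'e) metric_graph" where
  trivial: "p \<in> points M \<Longrightarrow> path_length M p 0 p"
| segment: "path_length M p l (curve M e s) \<Longrightarrow> e \<in> edges M \<Longrightarrow>
    s \<in> {0..len M e} \<Longrightarrow> t \<in> {0..len M e} \<Longrightarrow>
    path_length M p (l + \<bar>s - t\<bar>) (curve M e t)"

text \<open>
  Infimum and supremum stand for minimum and maximum; they are meaningful for connected graphs
  only, since otherwise the set of lengths may be empty.
\<close>

definition graph_dist :: "('p, 'e) metric_graph \<Rightarrow> 'p \<Rightarrow> 'p \<Rightarrow> real" where
  "graph_dist M p q = Inf {l. path_length M p l q}"

definition diam :: "('p, 'e) metric_graph \<Rightarrow> real" where
  "diam M = Sup {graph_dist M p q | p q. p \<in> points M \<and> q \<in> points M}"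

text \<open>
  Adding wormholes passes to the quotient by the equivalence relation that the wormholes
  generate. Wormholes are a list because their number counts; they may share points.
\<close>

definition identification :: "('p \<times> 'p) list \<Rightarrow> ('p \<times> 'p) set" where
  "identification W = (set W \<union> (set W)\<inverse>)\<^sup>*"

definition add_wormholes ::
    "('p, 'e) metric_graph \<Rightarrow> ('p \<times> 'p) list \<Rightarrow> ('p set, 'e) metric_graph" where
  "add_wormholes M W =
     \<lparr>points = points M // identification W,
      edges = edges M,
      len = len M,
      curve = (\<lambda>e t. identification W `` {curve M e t})\<rparr>"

definition wormholes :: "('p, 'e) metric_graph \<Rightarrow> ('p \<times> 'p) list \<Rightarrow> bool" where
  "wormholes M W \<longleftrightarrow> set W \<subseteq> points M \<times> points M"

definition single_edge :: "(nat, unit) pre_digraph" where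
  "single_edge = \<lparr>verts = {0, 1}, arcs = {()}, tail = (\<lambda>_. 0), head = (\<lambda>_. 1)\<rparr>"

definition path_graph :: "real \<Rightarrow> ((nat, unit) point, unit) metric_graph" where
  "path_graph L = metric_graph_of single_edge (\<lambda>_. L)"

lemma weighted_graph_single_edge: "L > 0 \<Longrightarrow> weighted_graph single_edge (\<lambda>_. L)"
  by unfold_locales (auto simp: single_edge_def)

text \<open>The path of length \<open>L\<close> is isometric to the interval \<open>{0..L}\<close>.\<close>

lemma path_graph_simps:
  "edges (path_graph L) = {()}"
  "len (path_graph L) e = L"
  "curve (path_graph L) e t = (if t = 0 then Vertex 0 else if t = L then Vertex 1 else Inner e t)"
  by (simp_all add: path_graph_def metric_graph_of_def single_edge_def)

lemma points_path_graph:
  assumes "L > 0"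
  shows "points (path_graph L) = curve (path_graph L) () ` {0..L}"
proof -
  have "points (path_graph L) = {Vertex 0, Vertex 1} \<union> {Inner () t | t. 0 < t \<and> t < L}"
    by (auto simp: path_graph_def metric_graph_of_def single_edge_def)
  then show ?thesis
    using assms by (force simp: path_graph_simps image_iff)
qed

lemma graph_dist_path_graph:
  assumes "L > 0" and s: "s \<in> {0..L}" and t: "t \<in> {0..L}"
  shows "graph_dist (path_graph L) (curve (path_graph L) () s) (curve (path_graph L) () t)
           = \<bar>s - t\<bar>"
proof -
  let ?M = "path_graph L"
  define c :: "(nat, unit) point \<Rightarrow> real"
    where "c p = (case p of Vertex v \<Rightarrow> if v = 0 then 0 else L | Inner e r \<Rightarrow> r)" for p
  have c: "c (curve ?M e r) = r" for e r
    by (simp add: c_def path_graph_simps)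
  have bound: "\<bar>c p - c q\<bar> \<le> l" if "path_length ?M p l q" for p l q
    using that by induction (auto simp: c)
  have "path_length ?M (curve ?M () s) (0 + \<bar>s - t\<bar>) (curve ?M () t)"
    using s t assms(1)
    by (intro path_length.intros) (auto simp: points_path_graph path_graph_simps(1,2))
  then show ?thesis
    unfolding graph_dist_def using bound[of "curve ?M () s" _ "curve ?M () t"]
    by (intro cInf_eq_minimum) (auto simp: c)
qed

end

theory Submission
  imports Defs "Jordan_Normal_Form.Determinant"
begin

text \<open>
  Lower bound: cut the path into \<open>w + 1\<close> intervals of length \<open>L / (w + 1)\<close>. A continuous function
  that is linear on each interval has \<open>w + 1\<close> slopes, and agreeing at the two ends of each of \<open>w\<close>
  wormholes is \<open>w\<close> linear conditions on them, so such a function descends to \<open>G\<^sub>w\<close> for some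
  nonzero slopes. Scaled to maximal slope \<open>1\<close> it is 1-Lipschitz on \<open>G\<^sub>w\<close>, so an interval where the
  slope is \<open>\<plusminus>1\<close> has its ends at distance at least \<open>L / (w + 1)\<close> in \<open>G\<^sub>w\<close>.

  Equality: identify the midpoints of these intervals to a single hub. Every point is then within
  half an interval of the hub.
\<close>

section \<open>Linear algebra: more unknowns than equations\<close>

text \<open>Padding the \<open>n\<close> by \<open>n + 1\<close> coefficient matrix with a zero row
  makes it square and singular, and any nonzero kernel vector is a solution.\<close>

lemma homogeneous_system_nontrivial_solution:
  fixes a :: "nat \<Rightarrow> nat \<Rightarrow> 'a::field"
  obtains x where "\<exists>j\<le>n. x j \<noteq> 0" "\<And>k. k < n \<Longrightarrow> (\<Sum>j\<le>n. a k j * x j) = 0"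
proof -
  define A where "A = Matrix.mat (Suc n) (Suc n) (\<lambda>(k, j). if k < n then a k j else 0)"
  have A: "A \<in> carrier_mat (Suc n) (Suc n)"
    by (simp add: A_def)
  have "Determinant.det A = (\<Sum>j<Suc n. A $$ (n, j) * cofactor A n j)"
    by (rule laplace_expansion_row[OF A]) simp
  also have "\<dots> = 0"
    by (intro sum.neutral) (simp add: A_def)
  finally obtain v where v: "v \<in> carrier_vec (Suc n)" "v \<noteq> 0\<^sub>v (Suc n)" "A *\<^sub>v v = 0\<^sub>v (Suc n)"
    using det_0_iff_vec_prod_zero_field[OF A] by blast
  show thesis
  proof (rule that)
    show "\<exists>j\<le>n. vec_index v j \<noteq> 0"
      using v(1,2) by (force simp: less_Suc_eq_le intro!: eq_vecI)
    show "(\<Sum>j\<le>n. a k j * vec_index v j) = 0" if "k < n" for k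
    proof -
      have "(\<Sum>j\<le>n. a k j * vec_index v j) = vec_index (A *\<^sub>v v) k"
        using v(1) that
        by (auto simp: A_def scalar_prod_def atLeast0LessThan lessThan_Suc_atMost intro!: sum.cong)
      then show ?thesis
        using v(3) that by simp
    qed
  qed
qed

section \<open>Path lengths in a quotient by wormholes\<close>

lemma equiv_identification: "equiv UNIV (identification W)"
  unfolding identification_def
  by (intro equivI) (auto intro: refl_rtrancl trans_rtrancl sym_rtrancl simp: sym_Un_converse)

lemma add_wormholes_simps:
  "points (add_wormholes M W) = points M // identification W"
  "edges (add_wormholes M W) = edges M"
  "len (add_wormholes M W) = len M"
  "curve (add_wormholes M W) e t = identification W `` {curve M e t}"
  by (simp_all add: add_wormholes_def)

lemma path_length_nonneg: "path_length M p l q \<Longrightarrow> l \<ge> 0"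
  by (induction rule: path_length.induct) auto

lemma graph_dist_le: "path_length M p l q \<Longrightarrow> graph_dist M p q \<le> l"
  unfolding graph_dist_def
  by (rule cInf_lower) (auto intro: bdd_belowI[of _ 0] path_length_nonneg)

text \<open>By \<open>W\<close>, \<open>g\<close> is constant on each class, so a jump inside a
  class changes nothing, while a segment changes \<open>g\<close> by at most its length.\<close>

lemma lipschitz_le_path_length_add_wormholes:
  fixes g :: "'p \<Rightarrow> real"
  assumes W: "\<And>p q. (p, q) \<in> set W \<Longrightarrow> g p = g q"
    and curve: "\<And>e s t. e \<in> edges M \<Longrightarrow> s \<in> {0..len M e} \<Longrightarrow> t \<in> {0..len M e} \<Longrightarrow>
      \<bar>g (curve M e s) - g (curve M e t)\<bar> \<le> \<bar>s - t\<bar>"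
    and "path_length (add_wormholes M W) P l Q" "p \<in> P" "q \<in> Q"
  shows "\<bar>g p - g q\<bar> \<le> l"
proof -
  have g_eq: "g p = g q" if "(p, q) \<in> identification W" for p q
    using that unfolding identification_def
    by (induction rule: rtrancl_induct) (auto dest: W)
  have refl: "(r, r) \<in> identification W" for r
    by (simp add: identification_def)
  \<comment> \<open>A segment may start at a representative other than the one considered last, so
    the claim is needed for every \<open>q\<close> in the end class.\<close>
  from assms(3-5) show ?thesis
  proof (induction arbitrary: q rule: path_length.induct)
    case (trivial P)
    then have "(p, q) \<in> identification W"
      using quotient_eq_iff[OF equiv_identification, of P W P p q]
      by (auto simp: add_wormholes_simps quotient_def)
    then show ?case
      using g_eq by simp
  next
    case (segment P l e s t)
    have "\<bar>g p - g (curve M e s)\<bar> \<le> l"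
      using segment.IH[OF segment.prems(1)] by (simp add: add_wormholes_simps refl)
    moreover have "\<bar>g (curve M e s) - g (curve M e t)\<bar> \<le> \<bar>s - t\<bar>"
      using segment by (intro curve) (auto simp: add_wormholes_simps)
    moreover have "g (curve M e t) = g q"
      using segment by (intro g_eq) (auto simp: add_wormholes_simps)
    ultimately show ?case
      by linarith
  qed
qed

section \<open>Distances and diameter of the path with wormholes\<close>

context
  fixes L :: real and W :: "((nat, unit) point \<times> (nat, unit) point) list"
  assumes L_pos: "L > 0"
begin

abbreviation (input) "path_with_wormholes \<equiv> add_wormholes (path_graph L) W"
abbreviation (input) "position \<equiv> curve path_with_wormholes ()"

lemma points_path_with_wormholes: "points path_with_wormholes = position ` {0..L}"
  by (auto simp: add_wormholes_simps points_path_graph[OF L_pos] quotient_def)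

lemma path_length_extend:
  "path_length path_with_wormholes P l (position s) \<Longrightarrow> s \<in> {0..L} \<Longrightarrow> t \<in> {0..L} \<Longrightarrow>
    path_length path_with_wormholes P (l + \<bar>s - t\<bar>) (position t)"
  by (rule path_length.segment) (simp_all add: add_wormholes_simps path_graph_simps)

lemma path_length_direct:
  assumes "s \<in> {0..L}" "t \<in> {0..L}"
  shows "path_length path_with_wormholes (position s) \<bar>s - t\<bar> (position t)"
proof -
  have "path_length path_with_wormholes (position s) 0 (position s)"
    using assms(1) by (intro path_length.trivial) (simp add: points_path_with_wormholes)
  from path_length_extend[OF this assms] show ?thesis
    by simp
qed

text \<open>The supremum in \<open>diam\<close> is over a bounded set, since the direct path along
  the edge keeps every distance at most \<open>L\<close>.\<close>

lemma graph_dist_le_diam: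
  assumes "s \<in> {0..L}" "t \<in> {0..L}"
  shows "graph_dist path_with_wormholes (position s) (position t) \<le> diam path_with_wormholes"
  unfolding diam_def
proof (rule cSup_upper)
  show "bdd_above {graph_dist path_with_wormholes p q |p q.
      p \<in> points path_with_wormholes \<and> q \<in> points path_with_wormholes}"
  proof (rule bdd_aboveI)
    fix d
    assume "d \<in> {graph_dist path_with_wormholes p q |p q.
      p \<in> points path_with_wormholes \<and> q \<in> points path_with_wormholes}"
    then obtain s t where st: "s \<in> {0..L}" "t \<in> {0..L}"
      and d: "d = graph_dist path_with_wormholes (position s) (position t)"
      unfolding points_path_with_wormholes by auto
    from st have "d \<le> \<bar>s - t\<bar>"
      unfolding d by (intro graph_dist_le path_length_direct)
    with st show "d \<le> L"
      by auto
  qed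
qed (use assms points_path_with_wormholes in blast)

lemma diam_leI:
  assumes "\<And>s t. s \<in> {0..L} \<Longrightarrow> t \<in> {0..L} \<Longrightarrow>
    graph_dist path_with_wormholes (position s) (position t) \<le> d"
  shows "diam path_with_wormholes \<le> d"
  unfolding diam_def
proof (rule cSup_least)
  have "position 0 \<in> points path_with_wormholes"
    using L_pos by (simp add: points_path_with_wormholes)
  then show "{graph_dist path_with_wormholes p q |p q.
      p \<in> points path_with_wormholes \<and> q \<in> points path_with_wormholes} \<noteq> {}"
    by blast
qed (use assms points_path_with_wormholes in auto)

text \<open>Read in the coordinate along the edge, \<open>f\<close> becomes a function of points
  that descends to the quotient. It bounds every path length from below, hence also their
  infimum.\<close>

lemma diam_ge_lipschitz:
  fixes f :: "real \<Rightarrow> real"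
  assumes W: "\<And>s t. s \<in> {0..L} \<Longrightarrow> t \<in> {0..L} \<Longrightarrow>
      (curve (path_graph L) () s, curve (path_graph L) () t) \<in> set W \<Longrightarrow> f s = f t"
    and wormholes: "wormholes (path_graph L) W"
    and f: "\<And>s t. s \<in> {0..L} \<Longrightarrow> t \<in> {0..L} \<Longrightarrow> \<bar>f s - f t\<bar> \<le> \<bar>s - t\<bar>"
    and st: "s \<in> {0..L}" "t \<in> {0..L}"
  shows "\<bar>f s - f t\<bar> \<le> diam path_with_wormholes"
proof -
  \<comment> \<open>\<open>c\<close> recovers the arc length parameter from a point of the
    path.\<close>
  define c :: "(nat, unit) point \<Rightarrow> real"
    where "c p = (case p of Vertex v \<Rightarrow> if v = 0 then 0 else L | Inner e r \<Rightarrow> r)" for p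
  have c: "c (curve (path_graph L) e r) = r" for e r
    by (simp add: c_def path_graph_simps)
  have "\<bar>f s - f t\<bar> \<le> l" if "path_length path_with_wormholes (position s) l (position t)" for l
  proof -
    have "\<bar>f (c (curve (path_graph L) () s)) - f (c (curve (path_graph L) () t))\<bar> \<le> l"
    proof (rule lipschitz_le_path_length_add_wormholes[OF _ _ that])
      show "f (c p) = f (c q)" if pq: "(p, q) \<in> set W" for p q
      proof -
        obtain s t where "s \<in> {0..L}" "p = curve (path_graph L) () s"
          "t \<in> {0..L}" "q = curve (path_graph L) () t"
          using pq wormholes by (auto simp: wormholes_def points_path_graph[OF L_pos])
        then show ?thesis
          using W[of s t] pq by (simp add: c)
      qed
    qed (use f in \<open>auto simp: c path_graph_simps(2) add_wormholes_simps identification_def\<close>)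
    then show ?thesis
      by (simp add: c)
  qed
  then have "\<bar>f s - f t\<bar> \<le> graph_dist path_with_wormholes (position s) (position t)"
    unfolding graph_dist_def using path_length_direct[OF st] by (intro cInf_greatest) auto
  also have "\<dots> \<le> diam path_with_wormholes"
    by (rule graph_dist_le_diam[OF st])
  finally show ?thesis .
qed

end

section \<open>Piecewise linear functions and the lower bound\<close>

text \<open>For \<open>l\<close> and \<open>t\<close> nonnegative this is the length of the part of
  \<open>{0..t}\<close> in the \<open>j\<close>-th interval of length \<open>l\<close>. As a
  function of \<open>t\<close> it has slope 1 on that interval and 0 elsewhere, so the coefficients
  of a linear combination are its slopes.\<close>

definition overlap :: "real \<Rightarrow> nat \<Rightarrow> real \<Rightarrow> real" where
  "overlap l j t = max 0 (min l (t - real j * l))"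

lemma overlap_mono: "s \<le> t \<Longrightarrow> overlap l j s \<le> overlap l j t"
  by (auto simp: overlap_def)

text \<open>The first \<open>n\<close> intervals tile \<open>{0..real n * l}\<close>, so the
  overlaps add up to the part of \<open>{0..t}\<close> inside it.\<close>

lemma sum_overlap:
  assumes "l \<ge> 0" "t \<ge> 0"
  shows "(\<Sum>j<n. overlap l j t) = min (real n * l) t"
proof (induction n)
  case (Suc n)
  then show ?case
    using assms by (auto simp: overlap_def algebra_simps)
qed (use assms in auto)

lemma overlap_at_cut:
  assumes "l \<ge> 0"
  shows "overlap l j (real i * l) = (if j < i then l else 0)"
proof (cases "j < i")
  case True
  then have "(real j + 1) * l \<le> real i * l"
    using assms by (intro mult_right_mono) auto
  then show ?thesis
    using True assms by (simp add: overlap_def algebra_simps)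
next
  case False
  then have "real i * l \<le> real j * l"
    using assms by (intro mult_right_mono) auto
  then show ?thesis
    using False assms by (simp add: overlap_def)
qed

text \<open>From \<open>s\<close> to a larger \<open>t\<close> all overlaps grow, by at most
  \<open>t - s\<close> in total, and coefficients of absolute value at most 1 cannot enlarge
  this.\<close>

lemma lipschitz_weighted_overlap:
  assumes "l \<ge> 0" "s \<ge> 0" "t \<ge> 0" and x: "\<And>j. j < n \<Longrightarrow> \<bar>x j\<bar> \<le> 1"
  shows "\<bar>(\<Sum>j<n. x j * overlap l j s) - (\<Sum>j<n. x j * overlap l j t)\<bar> \<le> \<bar>s - t\<bar>"
  using assms(2,3)
proof (induction s t rule: linorder_wlog)
  case (le s t)
  have "\<bar>(\<Sum>j<n. x j * overlap l j s) - (\<Sum>j<n. x j * overlap l j t)\<bar>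
      \<le> (\<Sum>j<n. \<bar>x j * (overlap l j s - overlap l j t)\<bar>)"
    by (simp only: sum_subtractf[symmetric] right_diff_distrib[symmetric] sum_abs)
  also have "\<dots> \<le> (\<Sum>j<n. 1 * (overlap l j t - overlap l j s))"
  proof (rule sum_mono)
    fix j assume "j \<in> {..<n}"
    then have "\<bar>x j\<bar> * \<bar>overlap l j s - overlap l j t\<bar> \<le> 1 * \<bar>overlap l j s - overlap l j t\<bar>"
      using x by (intro mult_right_mono) auto
    then show "\<bar>x j * (overlap l j s - overlap l j t)\<bar> \<le> 1 * (overlap l j t - overlap l j s)"
      using overlap_mono[OF le(1), of l j] by (simp add: abs_mult)
  qed
  also have "\<dots> = min (real n * l) t - min (real n * l) s"
    using le assms(1) by (simp add: sum_subtractf sum_overlap)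
  also have "\<dots> \<le> \<bar>s - t\<bar>"
    using le by auto
  finally show ?case .
next
  case (sym s t)
  then show ?case
    by (simp add: abs_minus_commute)
qed

lemma diam_add_wormholes_path_graph_ge:
  assumes "L > 0" and W: "wormholes (path_graph L) W"
  shows "diam (add_wormholes (path_graph L) W) \<ge> L / (real (length W) + 1)"
proof -
  define w where "w = length W"
  define l where "l = L / (real w + 1)"
  have l: "l > 0" and L: "(real w + 1) * l = L"
    using assms(1) by (simp_all add: l_def)
  let ?c = "curve (path_graph L) ()"
  have "\<exists>s t. W ! k = (?c s, ?c t)" if "k < w" for k
  proof -
    have "W ! k \<in> points (path_graph L) \<times> points (path_graph L)"
      using that W nth_mem[of k W] unfolding w_def wormholes_def by blast
    then show ?thesis
      unfolding points_path_graph[OF assms(1)] by blast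
  qed
  then obtain a b where ab: "\<And>k. k < w \<Longrightarrow> W ! k = (?c (a k), ?c (b k))"
    by metis
  \<comment> \<open>The unknown \<open>y j\<close> is the slope on the \<open>j\<close>-th interval.
    Equation \<open>k\<close> says that the function with these slopes agrees at \<open>a k\<close>
    and \<open>b k\<close>.\<close>
  obtain y where y: "\<exists>j\<le>w. y j \<noteq> 0"
    and y0: "\<And>k. k < w \<Longrightarrow> (\<Sum>j\<le>w. (overlap l j (a k) - overlap l j (b k)) * y j) = 0"
    by (rule homogeneous_system_nontrivial_solution
        [of w "\<lambda>k j. overlap l j (a k) - overlap l j (b k)"]) blast
  define Y where "Y = Max ((\<lambda>j. \<bar>y j\<bar>) ` {..w})"
  have Y_ge: "\<bar>y j\<bar> \<le> Y" if "j \<le> w" for j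
    unfolding Y_def using that by (intro Max_ge) auto
  have "Y \<in> (\<lambda>j. \<bar>y j\<bar>) ` {..w}"
    unfolding Y_def by (intro Max_in) auto
  \<comment> \<open>After division by \<open>Y\<close> the slope on interval \<open>i\<close> has
    absolute value 1.\<close>
  then obtain i where i: "i \<le> w" "\<bar>y i\<bar> = Y"
    by auto
  have Y: "Y > 0"
    using y Y_ge by force
  define f where "f t = (\<Sum>j<Suc w. y j / Y * overlap l j t)" for t
  have f_W: "f (a k) = f (b k)" if "k < w" for k
  proof -
    have "f (a k) - f (b k) = (\<Sum>j\<le>w. (overlap l j (a k) - overlap l j (b k)) * y j) / Y"
      unfolding f_def lessThan_Suc_atMost sum_subtractf[symmetric] sum_divide_distrib
      by (intro sum.cong) (simp_all add: algebra_simps diff_divide_distrib)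
    then show ?thesis
      using y0[OF that] by simp
  qed
  \<comment> \<open>The range of \<open>a k\<close> and \<open>b k\<close> was not recorded, so
    injectivity is shown for all real parameters.\<close>
  have inj: "s = t" if "?c s = ?c t" for s t
    using that assms(1) by (auto simp: path_graph_simps split: if_splits)
  \<comment> \<open>Between these consecutive cuts only the \<open>i\<close>-th overlap changes,
    from 0 to \<open>l\<close>.\<close>
  have "f (real (Suc i) * l) - f (real i * l)
      = (\<Sum>j<Suc w. if j = i then y i / Y * l else 0)"
    unfolding f_def sum_subtractf[symmetric]
    using l by (intro sum.cong) (auto simp: overlap_at_cut simp del: of_nat_Suc)
  also have "\<dots> = y i / Y * l"
    using i(1) by simp
  finally have "l = \<bar>f (real (Suc i) * l) - f (real i * l)\<bar>"
    using i(2) Y l by (simp add: abs_mult)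
  also have "\<dots> \<le> diam (add_wormholes (path_graph L) W)"
  proof (rule diam_ge_lipschitz[OF assms(1) _ W, where f = f])
    show "f s = f t" if st: "(?c s, ?c t) \<in> set W" for s t
    proof -
      obtain k where "k < w" "W ! k = (?c s, ?c t)"
        using st unfolding in_set_conv_nth w_def by blast
      moreover from this have "?c s = ?c (a k)" "?c t = ?c (b k)"
        using ab[of k] by simp_all
      then have "s = a k \<and> t = b k"
        using inj[of s "a k"] inj[of t "b k"] by blast
      ultimately show ?thesis
        using f_W by simp
    qed
    show "\<bar>f s - f t\<bar> \<le> \<bar>s - t\<bar>" if "s \<in> {0..L}" "t \<in> {0..L}" for s t
      unfolding f_def using that l Y Y_ge
      by (intro lipschitz_weighted_overlap) (auto simp: less_Suc_eq_le)
    have cut: "real j * l \<in> {0..L}" if "j \<le> Suc w" for j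
    proof -
      have "real j * l \<le> (real w + 1) * l"
        using that l by (intro mult_right_mono) auto
      then show ?thesis
        using l L by simp
    qed
    show "real (Suc i) * l \<in> {0..L}"
      by (rule cut) (use i(1) in simp)
    show "real i * l \<in> {0..L}"
      by (rule cut) (use i(1) in simp)
  qed
  finally show ?thesis
    by (simp add: l_def w_def)
qed

section \<open>Equality: a hub of midpoints\<close>

text \<open>The closed balls of radius \<open>r\<close> about the midpoints are consecutive
  intervals of length \<open>2 * r\<close>; the induction appends the last one.\<close>

lemma ex_midpoint_near:
  fixes s r :: real
  assumes "r > 0" "0 \<le> s" "s \<le> 2 * (real w + 1) * r"
  shows "\<exists>i\<le>w. \<bar>s - (2 * real i + 1) * r\<bar> \<le> r"
  using assms(3)
proof (induction w)
  case 0
  then show ?case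
    using assms by (auto simp: algebra_simps)
next
  case (Suc w)
  show ?case
  proof (cases "s \<le> 2 * (real w + 1) * r")
    case True
    then show ?thesis
      using Suc.IH le_SucI by blast
  next
    case False
    then show ?thesis
      using Suc.prems by (intro exI[of _ "Suc w"]) (auto simp: algebra_simps)
  qed
qed

text \<open>Only the upper bound is needed here: the lower bound holds for every choice of
  wormholes.\<close>

lemma ex_wormholes_diam_path_graph_le:
  assumes "L > 0"
  shows "\<exists>W. wormholes (path_graph L) W \<and> length W = w \<and>
    diam (add_wormholes (path_graph L) W) \<le> L / (real w + 1)"
proof -
  \<comment> \<open>\<open>r\<close> is half the length of an interval, so that \<open>h i\<close>
    below is the midpoint of the \<open>i\<close>-th one.\<close>
  define r where "r = L / (2 * (real w + 1))"
  have r: "r > 0" and L: "2 * (real w + 1) * r = L"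
    using assms by (simp_all add: r_def)
  define h where "h i = (2 * real i + 1) * r" for i :: nat
  have h: "h i \<in> {0..L}" if "i \<le> w" for i
  proof -
    have "(2 * real i + 1) * r \<le> 2 * (real w + 1) * r"
      using that r by (intro mult_right_mono) auto
    then show ?thesis
      unfolding L using r by (simp add: h_def)
  qed
  let ?c = "curve (path_graph L) ()"
  \<comment> \<open>A star centred at \<open>h 0\<close>: each wormhole attaches one further
    midpoint, so \<open>w\<close> of them join all \<open>w + 1\<close>.\<close>
  define W where "W = map (\<lambda>i. (?c (h 0), ?c (h (Suc i)))) [0..<w]"
  let ?M = "add_wormholes (path_graph L) W"
  have hub: "curve ?M () (h i) = curve ?M () (h 0)" if "i \<le> w" for i
  proof (cases i)
    case (Suc k)
    then have "(?c (h 0), ?c (h i)) \<in> set W"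
      using that by (auto simp: W_def)
    then have "(?c (h 0), ?c (h i)) \<in> identification W"
      unfolding identification_def by blast
    then show ?thesis
      using equiv_class_eq[OF equiv_identification, symmetric] by (simp add: add_wormholes_simps)
  qed simp
  have "diam ?M \<le> 2 * r"
  proof (rule diam_leI[OF assms])
    fix s t assume st: "s \<in> {0..L}" "t \<in> {0..L}"
    obtain i j where i: "i \<le> w" "\<bar>s - h i\<bar> \<le> r" and j: "j \<le> w" "\<bar>t - h j\<bar> \<le> r"
      using ex_midpoint_near[OF r, of s w] ex_midpoint_near[OF r, of t w] st L
      by (auto simp: h_def)
    \<comment> \<open>The leg to \<open>h i\<close> ends at the hub, which is also the position of
      \<open>h j\<close>, so the second leg can leave from there at no extra cost.\<close>
    have "path_length ?M (curve ?M () s) \<bar>s - h i\<bar> (curve ?M () (h j))"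
      using path_length_direct[OF assms st(1) h[OF i(1)], of W] hub[OF i(1)] hub[OF j(1)] by simp
    then have "graph_dist ?M (curve ?M () s) (curve ?M () t) \<le> \<bar>s - h i\<bar> + \<bar>h j - t\<bar>"
      using h[OF j(1)] st(2) by (intro graph_dist_le path_length_extend[OF assms])
    then show "graph_dist ?M (curve ?M () s) (curve ?M () t) \<le> 2 * r"
      using i j by linarith
  qed
  moreover have "wormholes (path_graph L) W"
    using h by (auto simp: wormholes_def W_def points_path_graph[OF assms])
  moreover have "length W = w"
    by (simp add: W_def)
  moreover have "2 * r = L / (real w + 1)"
    using L by (intro eq_divide_imp) (auto simp: algebra_simps)
  ultimately show ?thesis
    by auto
qed

theorem mainTheorem9:
  fixes L :: real and w :: nat
  assumes "L > 0"
  shows "(\<forall>W. wormholes (path_graph L) W \<and> length W = w \<longrightarrow>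
            diam (add_wormholes (path_graph L) W) \<ge> L / (real w + 1)) \<and>
         (\<exists>W. wormholes (path_graph L) W \<and> length W = w \<and>
            diam (add_wormholes (path_graph L) W) = L / (real w + 1))"
proof (intro conjI allI impI)
  show "diam (add_wormholes (path_graph L) W) \<ge> L / (real w + 1)"
    if "wormholes (path_graph L) W \<and> length W = w" for W
    using that diam_add_wormholes_path_graph_ge[OF assms, of W] by auto
  obtain W where W: "wormholes (path_graph L) W" "length W = w"
    "diam (add_wormholes (path_graph L) W) \<le> L / (real w + 1)"
    using ex_wormholes_diam_path_graph_le[OF assms] by blast
  then have "diam (add_wormholes (path_graph L) W) = L / (real w + 1)"
    using diam_add_wormholes_path_graph_ge[OF assms W(1)] by (intro antisym) simp_all
  with W show "\<exists>W. wormholes (path_graph L) W \<and> length W = w \<and>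
      diam (add_wormholes (path_graph L) W) = L / (real w + 1)"
    by blast
qed

end
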